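(* Let $A$ be a finite subset of a torsion-free additive abelian group $G$ with $|A|\ge 2$. For every integer $n>1$, $$|n\,\tilde{}A|\ge n|A|-2n+1+\{n\}_2\quad\text{and}\quad |n^\circ A|\ge n|A|-2n+(-1)^n(1+\{n\}_2).$$
   Context: For a finite subset $A$ of an additive abelian group and an integer $n>1$: $n\,\tilde{}A=\{a_1+\cdots+a_n:\ a_1,\dots,a_n\in A,\ a_i\ne a_{i+1}\text{ for all }1\le i<n\}$ and $n^\circ A=\{a_1+\cdots+a_n:\ a_1,\dots,a_n\in A,\ a_i\ne a_{i+1}\text{ for all }1\le i<n,\ \text{and } a_n\ne a_1\}$. $\{n\}_2$ denotes the least nonnegative residue of $n$ modulo $2$. *)

theory Defs
  imports Complex_Main
begin

definition path_sumset :: "nat \<Rightarrow> 'a::ab_group_add set \<Rightarrow> 'a set" where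
  "path_sumset n A =
    {\<Sum>i=1..n. a i | a.
      (\<forall>i\<in>{1..n}. a i \<in> A) \<and> (\<forall>i\<in>{1..<n}. a i \<noteq> a (i + 1))}"

definition cycle_sumset :: "nat \<Rightarrow> 'a::ab_group_add set \<Rightarrow> 'a set" where
  "cycle_sumset n A =
    {\<Sum>i=1..n. a i | a.
      (\<forall>i\<in>{1..n}. a i \<in> A) \<and> (\<forall>i\<in>{1..<n}. a i \<noteq> a (i + 1)) \<and> a n \<noteq> a 1}"

end

(* A torsion-free abelian group carries a translation-invariant linear order (Levi), given by a
   maximal set of positive elements. Write A = {b 0 < ... < b (k - 1)}. Starting from an admissible
   sequence with almost minimal sum, raise the index of one term at a time by one, staying
   admissible; each step strictly increases the sum, so the number of steps bounds the number of
   sums. If n is even, or for the open path, one goes from the alternating sequence 0,1,0,1,... to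
   k-2,k-1,k-2,k-1,... in n(k-2) steps, first raising all the 1s and then all the 0s; for the open
   path with n odd, swapping the two values at the end gives one more step. For the closed cycle
   with n odd one goes from 0,1,2,0,1,0,1,... to k-3,k-2,k-1,k-2,k-1,..., raising in this order the
   third term, the second, the odd-numbered ones from the fifth on, the first, and the
   even-numbered ones from the fourth on. *)
theory Submission
  imports Defs
begin

section \<open>Ordering a torsion-free abelian group and enumerating a finite subset\<close>

lemma sum_lessThan_const_add:
  fixes x :: "'a::comm_monoid_add" and m l :: nat
  shows "(\<Sum>i<m + l. x) = (\<Sum>i<m. x) + (\<Sum>i<l. x)"
  by (induction l) (auto simp: add.assoc)

lemma sum_lessThan_const_closed:
  fixes x :: "'a::comm_monoid_add" and m :: nat
  assumes "\<And>x y. x \<in> P \<Longrightarrow> y \<in> P \<Longrightarrow> x + y \<in> P" "x \<in> P" "m > 0"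
  shows "(\<Sum>i<m. x) \<in> P"
  using assms(3)
proof (induction m rule: nat_induct_non_zero)
  case 1
  then show ?case using assms(2) by (simp add: lessThan_Suc)
next
  case (Suc m)
  then show ?case using assms(1,2) by simp
qed

text \<open>Levi's theorem; \<open>P\<close> is the set of positive elements of the order.\<close>

lemma torsion_free_orderable:
  assumes torsion_free: "\<And>(x::'a::ab_group_add) (m::nat). m > 0 \<Longrightarrow> (\<Sum>i<m. x) = 0 \<Longrightarrow> x = 0"
  obtains P :: "'a::ab_group_add set" where "\<And>x y. x \<in> P \<Longrightarrow> y \<in> P \<Longrightarrow> x + y \<in> P" "0 \<notin> P"
    "\<And>x. x \<noteq> 0 \<Longrightarrow> x \<in> P \<or> - x \<in> P"
proof -
  \<comment> \<open>Cones of strictly positive elements. The empty set is one of them, which takes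
    care of the empty chain in Zorn's lemma.\<close>
  define F where "F = {P :: 'a set. (\<forall>x\<in>P. \<forall>y\<in>P. x + y \<in> P) \<and> 0 \<notin> P}"
  have "\<exists>U\<in>F. \<forall>X\<in>C. X \<subseteq> U" if C: "subset.chain F C" for C
  proof (rule bexI[of _ "\<Union>C"])
    have sub: "X \<subseteq> Y \<or> Y \<subseteq> X" if "X \<in> C" "Y \<in> C" for X Y
      using C that by (auto simp: subset_chain_def)
    have "x + y \<in> \<Union>C" if x: "x \<in> \<Union>C" and y: "y \<in> \<Union>C" for x y
    proof -
      obtain X Y where XY: "X \<in> C" "x \<in> X" "Y \<in> C" "y \<in> Y" using x y by blast
      then obtain Z where "Z \<in> C" "x \<in> Z" "y \<in> Z" using sub by blast
      moreover have "Z \<in> F" using C \<open>Z \<in> C\<close> by (auto simp: subset_chain_def)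
      ultimately show ?thesis unfolding F_def by blast
    qed
    moreover have "0 \<notin> \<Union>C" using C by (auto simp: subset_chain_def F_def)
    ultimately show "\<Union>C \<in> F" unfolding F_def by blast
  qed auto
  then obtain P where P: "P \<in> F" and max: "\<And>Q. Q \<in> F \<Longrightarrow> P \<subseteq> Q \<Longrightarrow> Q = P"
    using subset_Zorn[of F] by metis
  have add: "x + y \<in> P" if "x \<in> P" "y \<in> P" for x y using P that by (auto simp: F_def)
  have zero: "0 \<notin> P" using P by (auto simp: F_def)
  have neg_multiple: "\<exists>m::nat. m > 0 \<and> (\<Sum>i<m. - x) \<in> P" if x: "x \<noteq> 0" "x \<notin> P" for x
  proof -
    \<comment> \<open>The subsemigroup generated by \<open>P\<close> and \<open>x\<close>:
      \<open>p = 0\<close> stands for no summand from \<open>P\<close>, and the side condition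
      excludes the empty sum. Multiples are written as constant sums, the form in which
      torsion-freeness is assumed.\<close>
    define Q where
      "Q = {p + (\<Sum>i<m. x) | p (m::nat). p \<in> insert 0 P \<and> (p \<noteq> 0 \<or> m > 0)}"
    have QI: "p + (\<Sum>i<m. x) \<in> Q" if "p \<in> insert 0 P" "p \<noteq> 0 \<or> m > 0" for p and m :: nat
      unfolding Q_def using that by blast
    have "P \<subseteq> Q"
    proof
      fix p assume "p \<in> P"
      then show "p \<in> Q" using QI[of p 0] zero by auto
    qed
    moreover have "x \<in> Q" using QI[of 0 1] by (simp add: lessThan_Suc)
    \<comment> \<open>\<open>Q\<close> properly extends the maximal \<open>P\<close>. As
      \<open>Q\<close> is closed under addition, it can only fail to be in \<open>F\<close> by
      containing 0, and \<open>0 = p + m x\<close> makes a multiple of \<open>- x\<close> equal to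
      \<open>p\<close>.\<close>
    ultimately have "Q \<notin> F" using max x by blast
    moreover have "u + v \<in> Q" if u: "u \<in> Q" and v: "v \<in> Q" for u v
    proof -
      obtain p m where p: "u = p + (\<Sum>i<m. x)" "p \<in> insert 0 P" "p \<noteq> 0 \<or> (m::nat) > 0"
        using u unfolding Q_def by blast
      obtain q l where q: "v = q + (\<Sum>i<l. x)" "q \<in> insert 0 P" "q \<noteq> 0 \<or> (l::nat) > 0"
        using v unfolding Q_def by blast
      have "u + v = (p + q) + (\<Sum>i<m + l. x)"
        unfolding sum_lessThan_const_add p q by (simp add: algebra_simps)
      moreover have "p + q \<in> insert 0 P" using p q add by auto
      moreover have "p + q \<noteq> 0 \<or> m + l > 0"
        using p q add[of p q] zero by auto
      ultimately show ?thesis using QI[of "p + q" "m + l"] by simp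
    qed
    ultimately have "0 \<in> Q" unfolding F_def by blast
    then obtain p m where p: "0 = p + (\<Sum>i<m. x)" "p \<in> insert 0 P" "p \<noteq> 0 \<or> (m::nat) > 0"
      unfolding Q_def by blast
    have "m > 0" using p by (cases m) auto
    moreover have "p \<noteq> 0" using p torsion_free[OF \<open>m > 0\<close>, of x] x by auto
    moreover have "(\<Sum>i<m. - x) = p" using minus_unique[of "\<Sum>i<m. x" p] p(1)
      by (simp add: sum_negf add.commute)
    ultimately show ?thesis using p(2) by auto
  qed
  have "x \<in> P \<or> - x \<in> P" if x: "x \<noteq> 0" for x
  proof (rule ccontr)
    assume "\<not> (x \<in> P \<or> - x \<in> P)"
    then obtain m l :: nat where "m > 0" "(\<Sum>i<m. - x) \<in> P" "l > 0" "(\<Sum>i<l. x) \<in> P"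
      using neg_multiple[of x] neg_multiple[of "- x"] x by auto
    \<comment> \<open>Both elements are multiplied up to the common multiple \<open>m * l\<close>,
      where they cancel.\<close>
    then have "(\<Sum>j<l. \<Sum>i<m. - x) \<in> P" "(\<Sum>i<m. \<Sum>j<l. x) \<in> P"
      using sum_lessThan_const_closed[of P] add by auto
    then have "(\<Sum>j<l. \<Sum>i<m. - x) + (\<Sum>i<m. \<Sum>j<l. x) \<in> P" by (rule add)
    moreover have "(\<Sum>i<m. \<Sum>j<l. x) = (\<Sum>j<l. \<Sum>i<m. x)" by (rule sum.swap)
    ultimately show False using zero by (simp add: sum_negf)
  qed
  then show thesis using that add zero by blast
qed

text \<open>\<open>y - x \<in> P\<close> is a strict linear order, since two opposite differences in
  \<open>P\<close> would add up to 0; \<open>b\<close> reads off the sorted list of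
  \<open>A\<close>.\<close>

lemma finite_increasing_enumeration:
  fixes A P :: "'a::ab_group_add set"
  assumes add: "\<And>x y. x \<in> P \<Longrightarrow> y \<in> P \<Longrightarrow> x + y \<in> P" and zero: "0 \<notin> P"
    and total: "\<And>x. x \<noteq> 0 \<Longrightarrow> x \<in> P \<or> - x \<in> P" and "finite A"
  obtains b :: "nat \<Rightarrow> 'a" where "\<And>i. i < card A \<Longrightarrow> b i \<in> A"
    "\<And>i j. i < j \<Longrightarrow> j < card A \<Longrightarrow> b j - b i \<in> P"
proof -
  interpret ord: linorder "\<lambda>x y. x = y \<or> y - x \<in> P" "\<lambda>x y. y - x \<in> P"
  proof
    have asym: "\<not> (y - x \<in> P \<and> x - y \<in> P)" for x y
      using add[of "y - x" "x - y"] zero by auto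
    show "(y - x \<in> P) = ((x = y \<or> y - x \<in> P) \<and> \<not> (y = x \<or> x - y \<in> P))" for x y
      using asym[of x y] zero by auto
    show "x = x \<or> x - x \<in> P" for x by simp
    show "x = z \<or> z - x \<in> P" if "x = y \<or> y - x \<in> P" "y = z \<or> z - y \<in> P" for x y z
      using that add[of "y - x" "z - y"] by (auto simp: algebra_simps)
    show "x = y" if "x = y \<or> y - x \<in> P" "y = x \<or> x - y \<in> P" for x y
      using that asym[of x y] by auto
    show "(x = y \<or> y - x \<in> P) \<or> (y = x \<or> x - y \<in> P)" for x y
      using total[of "x - y"] by auto
  qed
  obtain xs where xs: "set xs = A" "sorted_wrt (\<lambda>x y. y - x \<in> P) xs" "length xs = card A"
    using ord.finite_set_strict_sorted[OF \<open>finite A\<close>] by blast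
  show thesis
  proof
    show "xs ! i \<in> A" if "i < card A" for i using that xs nth_mem[of i xs] by simp
    show "xs ! j - xs ! i \<in> P" if "i < j" "j < card A" for i j
      using that xs by (auto simp: sorted_wrt_iff_nth_less)
  qed
qed

section \<open>Chains of admissible index sequences with increasing sums\<close>

text \<open>\<open>E\<close> collects the pairs of positions whose entries must differ, so that the
  open path and the closed cycle are treated together. Sequences in \<open>A\<close> are represented
  by indices into \<open>b\<close>.\<close>

locale index_sequences =
  fixes P :: "'a::ab_group_add set" and b :: "nat \<Rightarrow> 'a" and k n :: nat and E :: "(nat \<times> nat) set"
  assumes add: "\<And>x y. x \<in> P \<Longrightarrow> y \<in> P \<Longrightarrow> x + y \<in> P" and zero: "0 \<notin> P"
    and increasing: "\<And>i j. i < j \<Longrightarrow> j < k \<Longrightarrow> b j - b i \<in> P"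
begin

definition admissible :: "(nat \<Rightarrow> nat) \<Rightarrow> bool" where
  "admissible f \<longleftrightarrow> (\<forall>i\<in>{1..n}. f i < k) \<and> (\<forall>(i, j)\<in>E. f i \<noteq> f j)"

definition total :: "(nat \<Rightarrow> nat) \<Rightarrow> 'a" where
  "total f = (\<Sum>i=1..n. b (f i))"

text \<open>As a relation, it has powers whose exponents count steps and add up under composition.
  Only the totals are compared, so a step may change many entries at once.\<close>

definition ascent :: "((nat \<Rightarrow> nat) \<times> (nat \<Rightarrow> nat)) set" where
  "ascent = {(f, g). admissible f \<and> admissible g \<and> total g - total f \<in> P}"

text \<open>\<open>P\<close> is closed under addition and omits 0, so the \<open>t + 1\<close>
  totals along the chain are distinct. Admissibility of \<open>f\<close> matters for
  \<open>t = 0\<close>, where no step supplies it.\<close>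

lemma card_totals_ge:
  assumes "(f, g) \<in> ascent ^^ t" "admissible f" "finite S" "\<And>f. admissible f \<Longrightarrow> total f \<in> S"
  shows "t + 1 \<le> card S"
proof -
  obtain \<phi> where \<phi>: "\<phi> 0 = f" "\<And>i. i < t \<Longrightarrow> (\<phi> i, \<phi> (Suc i)) \<in> ascent"
    using assms(1) unfolding relpow_fun_conv by blast
  have adm: "admissible (\<phi> i)" if "i \<le> t" for i
    using that assms(2) \<phi> by (cases i) (auto simp: ascent_def Suc_le_eq)
  have less: "total (\<phi> j) - total (\<phi> i) \<in> P" if "i < j" "j \<le> t" for i j
    using that
  proof (induction j)
    case (Suc j)
    have step: "total (\<phi> (Suc j)) - total (\<phi> j) \<in> P" using \<phi>(2)[of j] Suc.prems by (simp add: ascent_def)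
    show ?case
    proof (cases "i = j")
      case False
      then have "total (\<phi> j) - total (\<phi> i) \<in> P" using Suc by simp
      from add[OF step this] show ?thesis by simp
    qed (use step in simp)
  qed simp
  have "inj_on (\<lambda>i. total (\<phi> i)) {..t}"
  proof (rule inj_onI, rule ccontr)
    fix i j assume ij: "i \<in> {..t}" "j \<in> {..t}" "total (\<phi> i) = total (\<phi> j)" "i \<noteq> j"
    then show False using less[of i j] less[of j i] zero by (cases "i < j") auto
  qed
  moreover have "(\<lambda>i. total (\<phi> i)) ` {..t} \<subseteq> S" using adm assms(4) by auto
  ultimately have "card {..t} \<le> card S" using assms(3) by (metis card_inj_on_le)
  then show ?thesis by simp
qed

lemma total_upd:
  assumes "j \<in> {1..n}"
  shows "total (f(j := v)) - total f = b v - b (f j)"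
proof -
  have "total h = b (h j) + (\<Sum>i\<in>{1..n} - {j}. b (h i))" for h
    unfolding total_def using assms by (intro sum.remove) auto
  moreover have "(\<Sum>i\<in>{1..n} - {j}. b ((f(j := v)) i)) = (\<Sum>i\<in>{1..n} - {j}. b (f i))"
    by (intro sum.cong) auto
  ultimately show ?thesis by simp
qed

text \<open>Each unit raise of entry \<open>j\<close> changes the total by some
  \<open>b (Suc w) - b w\<close>, an element of \<open>P\<close>.\<close>

lemma raise_one:
  assumes "j \<in> {1..n}" "l \<le> u" "\<And>v. l \<le> v \<Longrightarrow> v \<le> u \<Longrightarrow> admissible (f(j := v))"
  shows "(f(j := l), f(j := u)) \<in> ascent ^^ (u - l)"
  using assms(2,3)
proof (induction u rule: dec_induct)
  case (step w)
  have adm: "admissible (f(j := w))" "admissible (f(j := Suc w))"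
    using step.prems[of w] step.prems[of "Suc w"] step.hyps(1) le_SucI le_refl by blast+
  \<comment> \<open>Admissibility keeps the new value in the range where \<open>b\<close> is known
    to increase.\<close>
  have "Suc w < k" using adm(2) assms(1) unfolding admissible_def by (metis fun_upd_same)
  then have "total (f(j := Suc w)) - total (f(j := w)) \<in> P"
    using total_upd[OF assms(1), of "f(j := w)" "Suc w"] increasing[of w "Suc w"] by simp
  then have "(f(j := w), f(j := Suc w)) \<in> ascent" using adm by (simp add: ascent_def)
  moreover have "(f(j := l), f(j := w)) \<in> ascent ^^ (w - l)"
    using step.IH[OF step.prems] le_SucI by blast
  ultimately have "(f(j := l), f(j := Suc w)) \<in> ascent ^^ Suc (w - l)" by (rule relpow_Suc_I[rotated])
  then show ?case using step.hyps by (simp only: Suc_diff_le)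
qed simp

text \<open>The entries in \<open>J\<close> are raised one after another. The last hypothesis covers
  every intermediate state, so their order is immaterial.\<close>

lemma raise:
  assumes "finite J" "J \<subseteq> {1..n}" "l \<le> u"
    "\<And>f. (\<And>i. i \<in> J \<Longrightarrow> l \<le> f i \<and> f i \<le> u) \<Longrightarrow> (\<And>i. i \<notin> J \<Longrightarrow> f i = e i) \<Longrightarrow> admissible f"
  shows "((\<lambda>i. if i \<in> J then l else e i), (\<lambda>i. if i \<in> J then u else e i))
    \<in> ascent ^^ (card J * (u - l))"
  using assms(1,2,4)
proof (induction J arbitrary: e)
  case (insert j J)
  define g where "g = (\<lambda>i. if i \<in> J then l else e i)"
  have "(g(j := l), g(j := u)) \<in> ascent ^^ (u - l)"
  proof (rule raise_one)
    show "admissible (g(j := v))" if "l \<le> v" "v \<le> u" for v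
    proof (rule insert.prems(2))
      show "l \<le> (g(j := v)) i \<and> (g(j := v)) i \<le> u" if "i \<in> insert j J" for i
        using that \<open>l \<le> v\<close> \<open>v \<le> u\<close> assms(3) by (auto simp: g_def)
    qed (simp add: g_def)
  qed (use insert.prems(1) assms(3) in auto)
  \<comment> \<open>Once raised, \<open>j\<close> belongs to the fixed background, which becomes
    \<open>e(j := u)\<close> in the induction hypothesis.\<close>
  moreover have "((\<lambda>i. if i \<in> J then l else (e(j := u)) i), (\<lambda>i. if i \<in> J then u else (e(j := u)) i))
    \<in> ascent ^^ (card J * (u - l))"
  proof (rule insert.IH)
    fix f assume f: "\<And>i. i \<in> J \<Longrightarrow> l \<le> f i \<and> f i \<le> u" "\<And>i. i \<notin> J \<Longrightarrow> f i = (e(j := u)) i"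
    have j: "f j = u" using f(2)[OF insert.hyps(2)] by simp
    show "admissible f"
    proof (rule insert.prems(2))
      show "l \<le> f i \<and> f i \<le> u" if "i \<in> insert j J" for i
        using that f(1)[of i] j assms(3) by (cases "i = j") auto
      show "f i = e i" if "i \<notin> insert j J" for i
        using that f(2)[of i] by auto
    qed
  qed (use insert.prems(1) in auto)
  moreover have "g(j := l) = (\<lambda>i. if i \<in> insert j J then l else e i)"
    "g(j := u) = (\<lambda>i. if i \<in> J then l else (e(j := u)) i)"
    "(\<lambda>i. if i \<in> J then u else (e(j := u)) i) = (\<lambda>i. if i \<in> insert j J then u else e i)"
    using insert.hyps by (auto simp: fun_eq_iff g_def)
  moreover have "card (insert j J) * (u - l) = (u - l) + card J * (u - l)"
    using insert.hyps by simp
  ultimately show ?case by (simp only: relpow_add) blast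
qed simp

text \<open>Version of \<open>raise\<close> with named endpoints, for plugging in concrete stages of
  a climb.\<close>

lemma raise_to:
  assumes "J \<subseteq> {1..n}" "l \<le> u" "t = card J * (u - l)"
    "\<And>i. i \<in> J \<Longrightarrow> f i = l" "\<And>i. i \<in> J \<Longrightarrow> g i = u" "\<And>i. i \<notin> J \<Longrightarrow> g i = f i"
    "\<And>h. (\<And>i. i \<in> J \<Longrightarrow> l \<le> h i \<and> h i \<le> u) \<Longrightarrow> (\<And>i. i \<notin> J \<Longrightarrow> h i = f i) \<Longrightarrow> admissible h"
  shows "(f, g) \<in> ascent ^^ t"
proof -
  have "finite J" using assms(1) by (rule finite_subset) simp
  from raise[OF this assms(1,2), of f, OF assms(7)]
  have "((\<lambda>i. if i \<in> J then l else f i), (\<lambda>i. if i \<in> J then u else f i)) \<in> ascent ^^ t"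
    unfolding assms(3) .
  moreover have "(\<lambda>i. if i \<in> J then l else f i) = f" "(\<lambda>i. if i \<in> J then u else f i) = g"
    using assms(4,5,6) by auto
  ultimately show ?thesis by simp
qed

section \<open>Alternating sequences: paths and even cycles\<close>

text \<open>The default 0 outside \<open>{1..n}\<close> makes any two such sequences agree there, as
  \<open>raise_to\<close> demands off \<open>J\<close>.\<close>

definition alternating :: "nat \<Rightarrow> nat \<Rightarrow> nat \<Rightarrow> nat" where
  "alternating x y i = (if i \<in> {1..n} then if odd i then x else y else 0)"

text \<open>If every constraint joins positions of opposite parity, it suffices to separate
  odd-position values from even-position values.\<close>

lemma admissible_bipartite:
  assumes E: "\<And>i j. (i, j) \<in> E \<Longrightarrow> i \<in> {1..n} \<and> j \<in> {1..n} \<and> even i \<noteq> even j"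
    and less: "\<And>i. i \<in> {1..n} \<Longrightarrow> f i < k"
    and neq: "\<And>i j. i \<in> {1..n} \<Longrightarrow> j \<in> {1..n} \<Longrightarrow> odd i \<Longrightarrow> even j \<Longrightarrow> f i \<noteq> f j"
  shows "admissible f"
proof -
  have "f i \<noteq> f j" if "(i, j) \<in> E" for i j
    using E[OF that] neq by metis
  then show ?thesis using less by (auto simp: admissible_def)
qed

text \<open>The even positions move within \<open>1..k - 1\<close> while the odd ones rest at 0;
  then the odd ones move within \<open>0..k - 2\<close> while the even ones rest at
  \<open>k - 1\<close>. Each of the \<open>n\<close> entries rises by \<open>k - 2\<close>.\<close>

lemma alternating_ascent:
  assumes E: "\<And>i j. (i, j) \<in> E \<Longrightarrow> i \<in> {1..n} \<and> j \<in> {1..n} \<and> even i \<noteq> even j" and k: "2 \<le> k"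
  shows "admissible (alternating 0 1)"
    and "(alternating 0 1, alternating (k - 2) (k - 1)) \<in> ascent ^^ (n * (k - 2))"
proof -
  let ?O = "{i \<in> {1..n}. odd i}" and ?E = "{i \<in> {1..n}. even i}"
  note adm = admissible_bipartite[OF E]
  show "admissible (alternating 0 1)" using k by (intro adm) (auto simp: alternating_def)
  have "(alternating 0 1, alternating 0 (k - 1)) \<in> ascent ^^ (card ?E * (k - 2))"
  proof (rule raise_to[of ?E 1 "k - 1"])
    fix h assume h: "\<And>i. i \<in> ?E \<Longrightarrow> 1 \<le> h i \<and> h i \<le> k - 1"
      "\<And>i. i \<notin> ?E \<Longrightarrow> h i = alternating 0 1 i"
    have odd: "h i = 0" if "odd i" for i using h(2)[of i] that by (simp add: alternating_def)
    show "admissible h"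
    proof (rule adm)
      show "h i < k" if "i \<in> {1..n}" for i using h(1)[of i] odd[of i] that k by (cases "odd i") auto
      show "h i \<noteq> h j" if "i \<in> {1..n}" "j \<in> {1..n}" "odd i" "even j" for i j
        using h(1)[of j] odd[of i] that by auto
    qed
  qed (use k in \<open>auto simp: alternating_def\<close>)
  moreover have "(alternating 0 (k - 1), alternating (k - 2) (k - 1)) \<in> ascent ^^ (card ?O * (k - 2))"
  proof (rule raise_to[of ?O 0 "k - 2"])
    fix h assume h: "\<And>i. i \<in> ?O \<Longrightarrow> 0 \<le> h i \<and> h i \<le> k - 2"
      "\<And>i. i \<notin> ?O \<Longrightarrow> h i = alternating 0 (k - 1) i"
    have even: "h i = k - 1" if "i \<in> {1..n}" "even i" for i
      using h(2)[of i] that by (simp add: alternating_def)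
    show "admissible h"
    proof (rule adm)
      show "h i < k" if "i \<in> {1..n}" for i using h(1)[of i] even[of i] that k by (cases "odd i") auto
      show "h i \<noteq> h j" if "i \<in> {1..n}" "j \<in> {1..n}" "odd i" "even j" for i j
        using h(1)[of i] even[of j] that k by auto
    qed
  qed (use k in \<open>auto simp: alternating_def\<close>)
  ultimately have "(alternating 0 1, alternating (k - 2) (k - 1))
      \<in> ascent ^^ (card ?E * (k - 2) + card ?O * (k - 2))"
    by (rule relpow_trans)
  moreover have "card ?E + card ?O = card (?E \<union> ?O)"
    by (rule card_Un_disjoint[symmetric]) auto
  moreover have "?E \<union> ?O = {1..n}" by auto
  ultimately show "(alternating 0 1, alternating (k - 2) (k - 1)) \<in> ascent ^^ (n * (k - 2))"
    by (simp flip: add_mult_distrib)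
qed

text \<open>For odd \<open>n\<close> there is one more odd position than even ones, so all changes
  but one cancel.\<close>

lemma total_alternating_swap:
  assumes "odd n"
  shows "total (alternating y x) - total (alternating x y) = b y - b x"
proof -
  have "(\<Sum>i=1..Suc (2 * m). b (if odd i then y else x))
      = (\<Sum>i=1..Suc (2 * m). b (if odd i then x else y)) + (b y - b x)" for m
    by (induction m) (auto simp: algebra_simps)
  moreover obtain m where "n = Suc (2 * m)" using assms by (auto elim: oddE)
  ultimately show ?thesis unfolding total_def alternating_def by simp
qed

text \<open>The extra step is the simultaneous swap of \<open>k - 2\<close> and
  \<open>k - 1\<close>: for odd \<open>n\<close> it moves the surplus entry up by one index.\<close>

lemma alternating_ascent_odd:
  assumes E: "\<And>i j. (i, j) \<in> E \<Longrightarrow> i \<in> {1..n} \<and> j \<in> {1..n} \<and> even i \<noteq> even j" and k: "2 \<le> k"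
    and "odd n"
  shows "(alternating 0 1, alternating (k - 1) (k - 2)) \<in> ascent ^^ Suc (n * (k - 2))"
proof -
  have "admissible (alternating x y)" if "x < k" "y < k" "x \<noteq> y" for x y
    using that by (intro admissible_bipartite[OF E]) (auto simp: alternating_def)
  then have "(alternating (k - 2) (k - 1), alternating (k - 1) (k - 2)) \<in> ascent"
    using total_alternating_swap[OF \<open>odd n\<close>, of "k - 1" "k - 2"] increasing[of "k - 2" "k - 1"] k
    by (auto simp: ascent_def)
  then show ?thesis using alternating_ascent(2)[OF E k] by auto
qed

section \<open>Odd cycles\<close>

text \<open>An odd cycle needs three distinct values, here \<open>x\<close>, \<open>y\<close>,
  \<open>z\<close>. For odd \<open>n \<ge> 5\<close> the tail starts with \<open>p\<close> next to
  \<open>z\<close> and ends with \<open>q\<close> next to \<open>x\<close>; for \<open>n = 3\<close>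
  it is empty. The default 0 serves as in \<open>alternating\<close>.\<close>

definition triangle_alternating ::
    "nat \<Rightarrow> nat \<Rightarrow> nat \<Rightarrow> nat \<Rightarrow> nat \<Rightarrow> nat \<Rightarrow> nat" where
  "triangle_alternating x y z p q i =
    (if i = 1 then x else if i = 2 then y else if i = 3 then z
     else if i \<in> {4..n} then if even i then p else q else 0)"

text \<open>In each stage the neighbours of a moving entry rest at values outside its range. The
  first three entries rise by \<open>k - 3\<close> each, the remaining \<open>n - 3\<close> by
  \<open>k - 2\<close>.\<close>

lemma odd_cycle_ascent:
  assumes E: "E = insert (n, 1) {(i, i + 1) | i. i \<in> {1..<n}}" and k: "3 \<le> k"
    and n: "odd n" "3 \<le> n"
  shows "admissible (triangle_alternating 0 1 2 0 1)"
    and "(triangle_alternating 0 1 2 0 1,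
      triangle_alternating (k - 3) (k - 2) (k - 1) (k - 2) (k - 1)) \<in> ascent ^^ (3 * (k - 3) + (n - 3) * (k - 2))"
proof -
  let ?O = "{i \<in> {4..n}. odd i}" and ?E = "{i \<in> {4..n}. even i}"
  \<comment> \<open>A sufficient criterion that sorts the tail by parity instead of by adjacency.
    The closing edge joins positions 3 and 1 if \<open>n = 3\<close>, and otherwise an odd tail
    position and 1.\<close>
  have adm: "admissible h"
    if less: "h 1 < k" "h 2 < k" "h 3 < k" "\<And>i. i \<in> {4..n} \<Longrightarrow> h i < k"
      and neq: "h 1 \<noteq> h 2" "h 2 \<noteq> h 3" "h 3 \<noteq> h 1" "\<And>i. i \<in> {4..n} \<Longrightarrow> even i \<Longrightarrow> h i \<noteq> h 3"
        "\<And>i. i \<in> {4..n} \<Longrightarrow> odd i \<Longrightarrow> h i \<noteq> h 1"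
        "\<And>i j. i \<in> {4..n} \<Longrightarrow> j \<in> {4..n} \<Longrightarrow> odd i \<Longrightarrow> even j \<Longrightarrow> h i \<noteq> h j" for h
  proof -
    have "h i < k" if "i \<in> {1..n}" for i
    proof -
      have "i = 1 \<or> i = 2 \<or> i = 3 \<or> i \<in> {4..n}" using that by auto
      then show ?thesis using less by blast
    qed
    moreover have "h i \<noteq> h (i + 1)" if i: "i \<in> {1..<n}" for i
    proof -
      consider "i = 1" | "i = 2" | "i = 3" | "i \<in> {4..n}" "i + 1 \<in> {4..n}" using i by fastforce
      then show ?thesis
      proof cases
        case 3
        then show ?thesis using neq(4)[of 4] i by simp
      next
        case 4
        then show ?thesis using neq(6)[of i "i + 1"] neq(6)[of "i + 1" i] by (cases "odd i") auto
      qed (use neq(1,2) in \<open>simp_all add: numeral_eq_Suc\<close>)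
    qed
    moreover have "h n \<noteq> h 1" using neq(3) neq(5)[of n] n by (cases "n = 3") auto
    ultimately have "\<forall>i\<in>{1..n}. h i < k" "\<forall>(i, j)\<in>E. h i \<noteq> h j" unfolding E by auto
    then show ?thesis unfolding admissible_def by blast
  qed
  show "admissible (triangle_alternating 0 1 2 0 1)"
    using k by (intro adm) (auto simp: triangle_alternating_def)
  have "(triangle_alternating 0 1 2 0 1, triangle_alternating 0 1 (k - 1) 0 1) \<in> ascent ^^ (k - 3)"
  proof (rule raise_to[of "{3}" 2 "k - 1"])
    fix h assume h: "\<And>i. i \<in> {3} \<Longrightarrow> 2 \<le> h i \<and> h i \<le> k - 1"
      "\<And>i. i \<notin> {3} \<Longrightarrow> h i = triangle_alternating 0 1 2 0 1 i"
    show "admissible h" using h(1)[of 3] k n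
      by (intro adm) (auto simp: h(2) triangle_alternating_def)
  qed (use k n in \<open>auto simp: triangle_alternating_def\<close>)
  moreover have "(triangle_alternating 0 1 (k - 1) 0 1, triangle_alternating 0 (k - 2) (k - 1) 0 1)
    \<in> ascent ^^ (k - 3)"
  proof (rule raise_to[of "{2}" 1 "k - 2"])
    fix h assume h: "\<And>i. i \<in> {2} \<Longrightarrow> 1 \<le> h i \<and> h i \<le> k - 2"
      "\<And>i. i \<notin> {2} \<Longrightarrow> h i = triangle_alternating 0 1 (k - 1) 0 1 i"
    show "admissible h" using h(1)[of 2] k n
      by (intro adm) (auto simp: h(2) triangle_alternating_def)
  qed (use k n in \<open>auto simp: triangle_alternating_def\<close>)
  \<comment> \<open>The odd tail entries stay above 0, where the even tail entries and the first
    entry rest.\<close>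
  moreover have "(triangle_alternating 0 (k - 2) (k - 1) 0 1,
      triangle_alternating 0 (k - 2) (k - 1) 0 (k - 1)) \<in> ascent ^^ (card ?O * (k - 2))"
  proof (rule raise_to[of ?O 1 "k - 1"])
    fix h assume h: "\<And>i. i \<in> ?O \<Longrightarrow> 1 \<le> h i \<and> h i \<le> k - 1"
      "\<And>i. i \<notin> ?O \<Longrightarrow> h i = triangle_alternating 0 (k - 2) (k - 1) 0 1 i"
    have fixed: "h 1 = 0" "h 2 = k - 2" "h 3 = k - 1" "\<And>j. j \<in> {4..n} \<Longrightarrow> even j \<Longrightarrow> h j = 0"
      by (auto simp: h(2) triangle_alternating_def)
    have raised: "0 < h i" "h i < k" if "i \<in> {4..n}" "odd i" for i
      using h(1)[of i] that k by auto
    show "admissible h"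
    proof (rule adm)
      show "h i < k" if "i \<in> {4..n}" for i
        using fixed(4)[of i] raised(2)[of i] that k by (cases "even i") auto
      show "h i \<noteq> h 3" if "i \<in> {4..n}" "even i" for i
        using fixed(3) fixed(4)[OF that] k by simp
      show "h i \<noteq> h 1" if "i \<in> {4..n}" "odd i" for i
        using fixed(1) raised(1)[OF that] by simp
      show "h i \<noteq> h j" if "i \<in> {4..n}" "j \<in> {4..n}" "odd i" "even j" for i j
        using fixed(4)[of j] raised(1)[of i] that by simp
    qed (use fixed(1-3) k in auto)
  qed (use k n in \<open>auto simp: triangle_alternating_def\<close>)
  \<comment> \<open>The first entry stays below its neighbours, which are \<open>k - 2\<close> at
    position 2 and \<open>k - 1\<close> at position \<open>n\<close>.\<close>
  moreover have "(triangle_alternating 0 (k - 2) (k - 1) 0 (k - 1),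
      triangle_alternating (k - 3) (k - 2) (k - 1) 0 (k - 1)) \<in> ascent ^^ (k - 3)"
  proof (rule raise_to[of "{1}" 0 "k - 3"])
    fix h assume h: "\<And>i. i \<in> {1} \<Longrightarrow> 0 \<le> h i \<and> h i \<le> k - 3"
      "\<And>i. i \<notin> {1} \<Longrightarrow> h i = triangle_alternating 0 (k - 2) (k - 1) 0 (k - 1) i"
    show "admissible h" using h(1)[of 1] k n
      by (intro adm) (auto simp: h(2) triangle_alternating_def)
  qed (use k n in \<open>auto simp: triangle_alternating_def\<close>)
  \<comment> \<open>The even tail entries stay below \<open>k - 1\<close>, the value of the third
    entry and of the odd tail.\<close>
  moreover have "(triangle_alternating (k - 3) (k - 2) (k - 1) 0 (k - 1),
      triangle_alternating (k - 3) (k - 2) (k - 1) (k - 2) (k - 1)) \<in> ascent ^^ (card ?E * (k - 2))"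
  proof (rule raise_to[of ?E 0 "k - 2"])
    fix h assume h: "\<And>i. i \<in> ?E \<Longrightarrow> 0 \<le> h i \<and> h i \<le> k - 2"
      "\<And>i. i \<notin> ?E \<Longrightarrow> h i = triangle_alternating (k - 3) (k - 2) (k - 1) 0 (k - 1) i"
    have fixed: "h 1 = k - 3" "h 2 = k - 2" "h 3 = k - 1"
        "\<And>j. j \<in> {4..n} \<Longrightarrow> odd j \<Longrightarrow> h j = k - 1"
      by (auto simp: h(2) triangle_alternating_def)
    have raised: "h i < k - 1" if "i \<in> {4..n}" "even i" for i
      using h(1)[of i] that k by auto
    show "admissible h"
    proof (rule adm)
      show "h i < k" if "i \<in> {4..n}" for i
        using fixed(4)[of i] raised[of i] that k by (cases "even i") auto
      show "h i \<noteq> h 3" if "i \<in> {4..n}" "even i" for i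
        using fixed(3) raised[OF that] by simp
      show "h i \<noteq> h 1" if "i \<in> {4..n}" "odd i" for i
        using fixed(1) fixed(4)[OF that] k by simp
      show "h i \<noteq> h j" if "i \<in> {4..n}" "j \<in> {4..n}" "odd i" "even j" for i j
        using fixed(4)[of i] raised[of j] that by simp
    qed (use fixed(1-3) k in auto)
  qed (use k n in \<open>auto simp: triangle_alternating_def\<close>)
  ultimately have "(triangle_alternating 0 1 2 0 1,
      triangle_alternating (k - 3) (k - 2) (k - 1) (k - 2) (k - 1))
    \<in> ascent ^^ ((k - 3) + (k - 3) + card ?O * (k - 2) + (k - 3) + card ?E * (k - 2))"
    by (intro relpow_trans)
  moreover have "r + r + c * t + r + d * t = 3 * r + (c + d) * t" for r c d t :: nat
    by (simp add: algebra_simps)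
  ultimately have "(triangle_alternating 0 1 2 0 1,
      triangle_alternating (k - 3) (k - 2) (k - 1) (k - 2) (k - 1))
    \<in> ascent ^^ (3 * (k - 3) + (card ?O + card ?E) * (k - 2))"
    by metis
  moreover have "card ?O + card ?E = card (?O \<union> ?E)"
    by (rule card_Un_disjoint[symmetric]) auto
  moreover have "?O \<union> ?E = {4..n}" by auto
  ultimately show "(triangle_alternating 0 1 2 0 1,
      triangle_alternating (k - 3) (k - 2) (k - 1) (k - 2) (k - 1))
    \<in> ascent ^^ (3 * (k - 3) + (n - 3) * (k - 2))"
    by simp
qed

end

section \<open>Transfer to the two sumsets\<close>

text \<open>Finiteness is essential for the count, as \<open>card\<close> of an infinite set is
  0.\<close>

lemma finite_bounded_sums:
  fixes A :: "'a::comm_monoid_add set" and n :: nat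
  assumes "finite A"
  shows "finite {\<Sum>i=1..n. a i | a. \<forall>i\<in>{1..n}. a i \<in> A}"
proof (induction n)
  case (Suc n)
  have "{\<Sum>i=1..Suc n. a i | a. \<forall>i\<in>{1..Suc n}. a i \<in> A}
    \<subseteq> (\<lambda>(x, y). x + y) ` ({\<Sum>i=1..n. a i | a. \<forall>i\<in>{1..n}. a i \<in> A} \<times> A)"
  proof
    fix s assume "s \<in> {\<Sum>i=1..Suc n. a i | a. \<forall>i\<in>{1..Suc n}. a i \<in> A}"
    then obtain a where "s = (\<Sum>i=1..n. a i) + a (Suc n)" "\<forall>i\<in>{1..n}. a i \<in> A" "a (Suc n) \<in> A"
      by auto
    then show "s \<in> (\<lambda>(x, y). x + y) ` ({\<Sum>i=1..n. a i | a. \<forall>i\<in>{1..n}. a i \<in> A} \<times> A)"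
      by (intro image_eqI[of _ _ "(\<Sum>i=1..n. a i, a (Suc n))"]) auto
  qed
  then show ?case
    by (rule finite_subset) (intro finite_imageI finite_cartesian_product Suc assms)
qed auto

theorem theorem1p4:
  fixes A :: "'a::ab_group_add set" and n :: nat
  assumes torsion_free: "\<And>(x::'a) (m::nat). m > 0 \<Longrightarrow> (\<Sum>i<m. x) = 0 \<Longrightarrow> x = 0"
    and "finite A" and "card A \<ge> 2" and "n > 1"
  shows "int (card (path_sumset n A)) \<ge> int n * int (card A) - 2 * int n + 1 + int (n mod 2)
    \<and> int (card (cycle_sumset n A)) \<ge> int n * int (card A) - 2 * int n + (- 1) ^ n * (1 + int (n mod 2))"
proof -
  obtain P :: "'a set" where add: "\<And>x y. x \<in> P \<Longrightarrow> y \<in> P \<Longrightarrow> x + y \<in> P" and zero: "0 \<notin> P"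
    and total: "\<And>x. x \<noteq> 0 \<Longrightarrow> x \<in> P \<or> - x \<in> P"
    using torsion_free_orderable torsion_free by metis
  obtain b where b: "\<And>i. i < card A \<Longrightarrow> b i \<in> A"
    and increasing: "\<And>i j. i < j \<Longrightarrow> j < card A \<Longrightarrow> b j - b i \<in> P"
    using finite_increasing_enumeration[OF add zero total \<open>finite A\<close>] by blast
  define k where "k = card A"
  have k: "2 \<le> k" using assms(3) by (simp add: k_def)
  have b_inj: "b i \<noteq> b j" if "i < k" "j < k" "i \<noteq> j" for i j
    using increasing[of i j] increasing[of j i] zero that by (auto simp: k_def neq_iff)
  define Ep where "Ep = {(i, i + 1) | i. i \<in> {1..<n}}"
  define Ec where "Ec = insert (n, 1) Ep"
  interpret path: index_sequences P b k n Ep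
    by unfold_locales (use add zero increasing in \<open>auto simp: k_def\<close>)
  interpret cycle: index_sequences P b k n Ec
    by unfold_locales (use add zero increasing in \<open>auto simp: k_def\<close>)
  have "path_sumset n A \<subseteq> {\<Sum>i=1..n. a i | a. \<forall>i\<in>{1..n}. a i \<in> A}"
    "cycle_sumset n A \<subseteq> {\<Sum>i=1..n. a i | a. \<forall>i\<in>{1..n}. a i \<in> A}"
    unfolding path_sumset_def cycle_sumset_def by blast+
  then have fin: "finite (path_sumset n A)" "finite (cycle_sumset n A)"
    using finite_bounded_sums[OF \<open>finite A\<close>] finite_subset by blast+
  have path_total: "path.total f \<in> path_sumset n A" if "path.admissible f" for f
  proof -
    have f: "\<forall>i\<in>{1..n}. f i < k" "\<forall>(i, j)\<in>Ep. f i \<noteq> f j"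
      using that unfolding path.admissible_def by blast+
    have "\<forall>i\<in>{1..n}. b (f i) \<in> A" using f(1) b by (simp add: k_def)
    moreover have "b (f i) \<noteq> b (f (i + 1))" if "i \<in> {1..<n}" for i
      using f that by (intro b_inj) (auto simp: Ep_def)
    ultimately show ?thesis unfolding path_sumset_def path.total_def by blast
  qed
  have cycle_total: "cycle.total f \<in> cycle_sumset n A" if "cycle.admissible f" for f
  proof -
    have "\<forall>i\<in>{1..n}. f i < k" "\<forall>(i, j)\<in>Ec. f i \<noteq> f j"
      using that unfolding cycle.admissible_def by blast+
    then have f: "\<forall>i\<in>{1..n}. f i < k" "\<forall>(i, j)\<in>Ep. f i \<noteq> f j" "f n \<noteq> f 1"
      unfolding Ec_def by auto
    have "\<forall>i\<in>{1..n}. b (f i) \<in> A" using f(1) b by (simp add: k_def)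
    moreover have "b (f i) \<noteq> b (f (i + 1))" if "i \<in> {1..<n}" for i
      using f(1,2) that by (intro b_inj) (auto simp: Ep_def)
    moreover have "b (f n) \<noteq> b (f 1)" using f(1,3) \<open>n > 1\<close> by (intro b_inj) auto
    ultimately show ?thesis unfolding cycle_sumset_def cycle.total_def by blast
  qed
  have Ep: "i \<in> {1..n} \<and> j \<in> {1..n} \<and> even i \<noteq> even j" if "(i, j) \<in> Ep" for i j
    using that by (auto simp: Ep_def)
  \<comment> \<open>The natural-number difference \<open>k - 2\<close> is truncated;
    \<open>2 \<le> k\<close> makes it agree with the integer one.\<close>
  have steps: "int (n * (k - 2)) = int n * int k - 2 * int n"
    using k by (simp add: of_nat_diff algebra_simps)
  show ?thesis
  proof (cases "even n")
    case True
    \<comment> \<open>The closing edge joins \<open>n\<close> and 1, of opposite parity precisely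
      because \<open>n\<close> is even.\<close>
    have Ec: "i \<in> {1..n} \<and> j \<in> {1..n} \<and> even i \<noteq> even j" if "(i, j) \<in> Ec" for i j
      using that Ep[of i j] True \<open>n > 1\<close> by (auto simp: Ec_def)
    have "n * (k - 2) + 1 \<le> card (path_sumset n A)"
      by (rule path.card_totals_ge[OF path.alternating_ascent(2,1)[OF Ep k] fin(1) path_total])
    moreover have "n * (k - 2) + 1 \<le> card (cycle_sumset n A)"
      by (rule cycle.card_totals_ge[OF cycle.alternating_ascent(2,1)[OF Ec k] fin(2) cycle_total])
    ultimately have "int n * int k - 2 * int n + 1 \<le> int (card (path_sumset n A))"
      "int n * int k - 2 * int n + 1 \<le> int (card (cycle_sumset n A))"
      unfolding steps[symmetric] by linarith+
    then show ?thesis using True by (simp add: k_def)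
  next
    case False
    have "Suc (n * (k - 2)) + 1 \<le> card (path_sumset n A)"
      by (rule path.card_totals_ge[OF path.alternating_ascent_odd[OF Ep k False]
            path.alternating_ascent(1)[OF Ep k] fin(1) path_total])
    then have "int n * int k - 2 * int n + 2 \<le> int (card (path_sumset n A))"
      unfolding steps[symmetric] by linarith
    moreover have "int n * int k - 2 * int n - 2 \<le> int (card (cycle_sumset n A))"
    \<comment> \<open>For \<open>k = 2\<close> the bound is -2 and holds trivially; otherwise three
      values are available for the odd cycle.\<close>
    proof (cases "k = 2")
      case k2: False
      have "3 \<le> n" using False \<open>n > 1\<close> by presburger
      have "3 \<le> k" using k k2 by simp
      note ascent = cycle.odd_cycle_ascent[OF Ec_def[unfolded Ep_def] \<open>3 \<le> k\<close> False \<open>3 \<le> n\<close>]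
      have "3 * (k - 3) + (n - 3) * (k - 2) + 1 \<le> card (cycle_sumset n A)"
        by (rule cycle.card_totals_ge[OF ascent(2,1) fin(2) cycle_total])
      moreover have "int (3 * (k - 3) + (n - 3) * (k - 2) + 1) = int n * int k - 2 * int n - 2"
      proof -
        \<comment> \<open>Writing both numbers as 3 plus a remainder removes the truncated
          differences.\<close>
        obtain n' k' where "n = 3 + n'" "k = 3 + k'"
          using \<open>3 \<le> n\<close> \<open>3 \<le> k\<close> le_Suc_ex by blast
        then show ?thesis by (simp add: algebra_simps)
      qed
      ultimately show ?thesis by linarith
    qed simp
    ultimately show ?thesis using False by (simp add: odd_iff_mod_2_eq_one k_def)
  qed
qed

end
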